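(* Let $\Xi$ be the transformation of the parameters defined by $$(\nu_1,\dots,\nu_8;\kappa_1,\kappa_2;f,g)\mapsto\Bigl(\tfrac{\nu_1\nu_5\nu_6}{\kappa_2},\tfrac{\nu_2\nu_5\nu_6}{\kappa_2},\tfrac{\kappa_1}{q\nu_4},\tfrac{\kappa_1}{q\nu_3},\tfrac{\nu_5\nu_1\nu_2}{\kappa_2},\tfrac{\nu_6\nu_1\nu_2}{\kappa_2},\tfrac{\kappa_1}{q\nu_8},\tfrac{\kappa_1}{q\nu_7};\ \tfrac{\kappa_1^3}{q^2\nu_3\nu_4\nu_7\nu_8},\ \tfrac{\nu_1\nu_2\nu_5\nu_6}{\kappa_2};\ \tfrac{f\kappa_1}{q\nu_3\nu_4},\ \tfrac{g\kappa_2}{\nu_5\nu_6}\Bigr).$$ Then $\Xi$ is within the equivalence of the parameters of type $D_5^{(1)}$, i.e. $$(\Xi(\nu_1),\dots,\Xi(\nu_8);\Xi(\kappa_1),\Xi(\kappa_2);\Xi(f),\Xi(g))\sim(\nu_1,\dots,\nu_8;\kappa_1,\kappa_2;f,g).$$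
   Context: Let $K=\mathbb{C}(\nu_1,\dots,\nu_8,\kappa_1,\kappa_2,f,g)$ be the field of rational functions in 12 independent variables, and put $q=\kappa_1^2\kappa_2^2/(\nu_1\nu_2\cdots\nu_8)\in K$ (i.e. $\kappa_1^2\kappa_2^2=q\,\nu_1\cdots\nu_8$). Equivalence of type $D_5^{(1)}$: two tuples $y'$ and $y=(\nu_1,\dots,\nu_8;\kappa_1,\kappa_2;f,g)$ with entries in $K$ satisfy $y'\sim y$ iff there exist $a,b,c,d\in K\setminus\{0\}$ such that $$y'=(a\nu_1,a\nu_2,b\nu_3,b\nu_4,c\nu_5,c\nu_6,d\nu_7,d\nu_8;\ bd\,\kappa_1,\ ac\,\kappa_2;\ bf,\ g/a).$$ *)

theory Defs
  imports
    Complex_Main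
    "HOL-Library.Numeral_Type"
    "HOL-Library.Poly_Mapping"
    "HOL-Computational_Algebra.Fraction_Field"
begin

text \<open>
  The polynomial ring over the complex numbers in the twelve indeterminates indexed by the
  twelve-element type \<open>12\<close>: finitely supported coefficient functions on finitely supported
  exponent vectors, multiplied by convolution. The field \<open>K\<close> is its field of fractions.
\<close>

type_synonym poly12 = "(12 \<Rightarrow>\<^sub>0 nat) \<Rightarrow>\<^sub>0 complex"

type_synonym K = "poly12 fract"

definition indet :: "12 \<Rightarrow> K" where
  "indet i = Fract (Poly_Mapping.single (Poly_Mapping.single i 1) 1) 1"

text \<open>
  Tuples are ordered as
  \<open>(\<nu>\<^sub>1, \<dots>, \<nu>\<^sub>8; \<kappa>\<^sub>1, \<kappa>\<^sub>2; f, g)\<close>.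
\<close>

type_synonym params =
  "K \<times> K \<times> K \<times> K \<times> K \<times> K \<times> K \<times> K \<times> K \<times> K \<times> K \<times> K"

definition generic :: params where
  "generic =
    (indet 0, indet 1, indet 2, indet 3, indet 4, indet 5, indet 6, indet 7,
     indet 8, indet 9,
     indet 10, indet 11)"

fun D5_equiv :: "params \<Rightarrow> params \<Rightarrow> bool"  (infix \<open>\<sim>\<close> 50) where
  "y' \<sim> (\<nu>1, \<nu>2, \<nu>3, \<nu>4, \<nu>5, \<nu>6, \<nu>7, \<nu>8, \<kappa>1, \<kappa>2, f, g) \<longleftrightarrow>
    (\<exists>a b c d. a \<noteq> 0 \<and> b \<noteq> 0 \<and> c \<noteq> 0 \<and> d \<noteq> 0 \<and>
      y' = (a * \<nu>1, a * \<nu>2, b * \<nu>3, b * \<nu>4, c * \<nu>5, c * \<nu>6, d * \<nu>7, d * \<nu>8,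
            b * d * \<kappa>1, a * c * \<kappa>2,
            b * f, g / a))"

fun Xi :: "params \<Rightarrow> params" where
  "Xi (\<nu>1, \<nu>2, \<nu>3, \<nu>4, \<nu>5, \<nu>6, \<nu>7, \<nu>8, \<kappa>1, \<kappa>2, f, g) =
    (let q = \<kappa>1\<^sup>2 * \<kappa>2\<^sup>2 / (\<nu>1 * \<nu>2 * \<nu>3 * \<nu>4 * \<nu>5 * \<nu>6 * \<nu>7 * \<nu>8) in
      (\<nu>1 * \<nu>5 * \<nu>6 / \<kappa>2, \<nu>2 * \<nu>5 * \<nu>6 / \<kappa>2, \<kappa>1 / (q * \<nu>4), \<kappa>1 / (q * \<nu>3),
       \<nu>5 * \<nu>1 * \<nu>2 / \<kappa>2, \<nu>6 * \<nu>1 * \<nu>2 / \<kappa>2, \<kappa>1 / (q * \<nu>8), \<kappa>1 / (q * \<nu>7),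
       \<kappa>1 ^ 3 / (q\<^sup>2 * \<nu>3 * \<nu>4 * \<nu>7 * \<nu>8), \<nu>1 * \<nu>2 * \<nu>5 * \<nu>6 / \<kappa>2,
       f * \<kappa>1 / (q * \<nu>3 * \<nu>4), g * \<kappa>2 / (\<nu>5 * \<nu>6)))"

end

theory Submission
  imports Defs
begin

text \<open>\<open>Xi\<close> is itself a rescaling of the allowed kind: it multiplies each of the
  pairs (1,2), (3,4), (5,6), (7,8) of the \<nu> by a common factor, since for instance \<kappa>1/(q
  \<nu>4) = b \<nu>3 and \<kappa>1/(q \<nu>3) = b \<nu>4 with b = \<kappa>1/(q \<nu>3 \<nu>4). The
  images of \<kappa>1, \<kappa>2, f, g then fit the same factors.\<close>

lemma indet_nonzero: "indet i \<noteq> 0"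
proof -
  have "Poly_Mapping.single (Poly_Mapping.single i (1::nat)) (1::complex) \<noteq> 0"
    by (metis lookup_single_eq lookup_zero zero_neq_one)
  then show ?thesis
    by (simp add: indet_def Zero_fract_def eq_fract)
qed

lemma Xi_D5_equiv:
  assumes "\<nu>1 \<noteq> 0" "\<nu>2 \<noteq> 0" "\<nu>3 \<noteq> 0" "\<nu>4 \<noteq> 0" "\<nu>5 \<noteq> 0" "\<nu>6 \<noteq> 0" "\<nu>7 \<noteq> 0" "\<nu>8 \<noteq> 0"
    and "\<kappa>1 \<noteq> 0" "\<kappa>2 \<noteq> 0"
  shows "Xi (\<nu>1, \<nu>2, \<nu>3, \<nu>4, \<nu>5, \<nu>6, \<nu>7, \<nu>8, \<kappa>1, \<kappa>2, f, g)
    \<sim> (\<nu>1, \<nu>2, \<nu>3, \<nu>4, \<nu>5, \<nu>6, \<nu>7, \<nu>8, \<kappa>1, \<kappa>2, f, g)"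
proof -
  define q where "q = \<kappa>1\<^sup>2 * \<kappa>2\<^sup>2 / (\<nu>1 * \<nu>2 * \<nu>3 * \<nu>4 * \<nu>5 * \<nu>6 * \<nu>7 * \<nu>8)"
  have "q \<noteq> 0"
    using assms by (simp add: q_def)
  with assms show ?thesis
    \<comment> \<open>Folding \<open>q\<close> back leaves it as one nonzero atom for
      \<open>field_simps\<close>.\<close>
    unfolding D5_equiv.simps Xi.simps Let_def q_def[symmetric]
    \<comment> \<open>The witnesses a, b, c, d are the ratios of new to old \<nu>1, \<nu>3, \<nu>5,
      \<nu>7.\<close>
    by (intro exI[of _ "\<nu>5 * \<nu>6 / \<kappa>2"] exI[of _ "\<kappa>1 / (q * \<nu>3 * \<nu>4)"]
        exI[of _ "\<nu>1 * \<nu>2 / \<kappa>2"] exI[of _ "\<kappa>1 / (q * \<nu>7 * \<nu>8)"])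
      (simp add: field_simps power2_eq_square power3_eq_cube)
qed

theorem proposition3p6:
  shows "Xi generic \<sim> generic"
  unfolding generic_def by (intro Xi_D5_equiv indet_nonzero)

end
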